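(* Let $G$ have $m$ edges. A state $\mathcal{S}_T$ of the rotor-router system on $G$ is stable if and only if $$\sum_{i=1}^{3m}\Phi_i(\mathcal{S}_T)=\sum_{i=1}^{3m}\Phi_i(\mathcal{S}_{T+2m^2}).$$
   Context: Rotor-router model: $G=(V,E)$ is a finite connected undirected graph with $m$ edges; $\vec G=(V,\vec E)$ replaces each edge $\{u,v\}$ by arcs $(u,v),(v,u)$. Each vertex $v$ has a fixed cyclic ordering $\rho_v$ of its outgoing arcs, with $\mathit{next}(e)$ the successor of $e$ in $\rho_v$. A state $\mathcal{S}_t$ consists of a pointer $\mathit{pointer}_v$ (an outgoing arc of $v$) and a number of identical tokens at each vertex $v$. In each synchronous step every vertex $v$, while it has tokens, sends one token along $\mathit{pointer}_v$ and sets $\mathit{pointer}_v:=\mathit{next}(\mathit{pointer}_v)$; tokens sent at step $t$ are at the heads of their arcs at time $t+1$. $\mathcal{S}_t$ is stable if $\mathcal{S}_{t'}=\mathcal{S}_t$ for some $t'>t$. $\mathcal{L}_t(e)$ is the number of tokens sent along arc $e$ at step $t$; $\mathcal{C}_{t_1}^{t_2}(e)=\sum_{t_1\le t<t_2}\mathcal{L}_t(e)$; $\Phi_i(\mathcal{S}_t)=\sum_{e\in\vec E}(\mathcal{C}_t^{t+i}(e))^2$. *)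

theory Defs
  imports "Graph_Theory.Digraph_Component" "HOL-Combinatorics.Orbits"
begin

definition finite_simple_graph :: "'v set \<Rightarrow> 'v set set \<Rightarrow> bool" where
  "finite_simple_graph V E \<longleftrightarrow> finite V \<and> (\<forall>e\<in>E. e \<subseteq> V \<and> card e = 2)"

definition bidirected :: "'v set \<Rightarrow> 'v set set \<Rightarrow> ('v, 'v \<times> 'v) pre_digraph" where
  "bidirected V E = \<lparr>verts = V, arcs = {(u, v). {u, v} \<in> E}, tail = fst, head = snd\<rparr>"

text \<open>The cyclic orderings of the outgoing arcs at all vertices are given by a single
  successor function \<open>nxt\<close> on arcs, which must permute the outgoing arcs of each vertex in
  one cycle. The case distinction is needed since \<^const>\<open>cyclic_on\<close> fails on the empty set.\<close>

definition rotor_order :: "('v, 'a) pre_digraph \<Rightarrow> ('a \<Rightarrow> 'a) \<Rightarrow> bool" where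
  "rotor_order G nxt \<longleftrightarrow>
     (\<forall>v\<in>verts G. out_arcs G v \<noteq> {} \<longrightarrow> cyclic_on nxt (out_arcs G v))"

record ('v, 'a) rotor_state =
  pointer :: "'v \<Rightarrow> 'a"
  tokens :: "'v \<Rightarrow> nat"

text \<open>There are no tokens outside the graph. As a consequence, a step never changes the
  values of \<^const>\<open>pointer\<close> and \<^const>\<open>tokens\<close> outside the graph, so two states of the same
  evolution are equal iff they agree on the vertices. A vertex without outgoing arcs
  admits no pointer, so the one-vertex graph has no state.\<close>

definition rotor_state_on :: "('v, 'a) pre_digraph \<Rightarrow> ('v, 'a) rotor_state \<Rightarrow> bool" where
  "rotor_state_on G S \<longleftrightarrow>
     (\<forall>v\<in>verts G. pointer S v \<in> out_arcs G v) \<and> (\<forall>v. v \<notin> verts G \<longrightarrow> tokens S v = 0)"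

text \<open>A vertex \<open>v\<close> releases its tokens one after the other and advances its pointer after each
  of them, so its tokens number \<open>j = 0, 1, \<dots>\<close> leave along the arc \<open>(nxt ^^ j) (pointer S v)\<close>.\<close>

definition sent :: "('v, 'a) pre_digraph \<Rightarrow> ('a \<Rightarrow> 'a) \<Rightarrow> ('v, 'a) rotor_state \<Rightarrow> 'a \<Rightarrow> nat" where
  "sent G nxt S e =
     card {j. j < tokens S (tail G e) \<and> (nxt ^^ j) (pointer S (tail G e)) = e}"

definition rotor_step ::
    "('v, 'a) pre_digraph \<Rightarrow> ('a \<Rightarrow> 'a) \<Rightarrow> ('v, 'a) rotor_state \<Rightarrow> ('v, 'a) rotor_state" where
  "rotor_step G nxt S =
     \<lparr>pointer = (\<lambda>v. (nxt ^^ tokens S v) (pointer S v)),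
      tokens = (\<lambda>v. \<Sum>e\<in>in_arcs G v. sent G nxt S e)\<rparr>"

text \<open>In the following, \<open>S0\<close> is the initial state and \<open>state_at G nxt S0 t\<close> is the state at time \<open>t\<close>.\<close>

definition state_at ::
    "('v, 'a) pre_digraph \<Rightarrow> ('a \<Rightarrow> 'a) \<Rightarrow> ('v, 'a) rotor_state \<Rightarrow> nat \<Rightarrow> ('v, 'a) rotor_state" where
  "state_at G nxt S0 t = (rotor_step G nxt ^^ t) S0"

definition stable_at ::
    "('v, 'a) pre_digraph \<Rightarrow> ('a \<Rightarrow> 'a) \<Rightarrow> ('v, 'a) rotor_state \<Rightarrow> nat \<Rightarrow> bool" where
  "stable_at G nxt S0 t \<longleftrightarrow> (\<exists>t'>t. state_at G nxt S0 t' = state_at G nxt S0 t)"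

definition load ::
    "('v, 'a) pre_digraph \<Rightarrow> ('a \<Rightarrow> 'a) \<Rightarrow> ('v, 'a) rotor_state \<Rightarrow> nat \<Rightarrow> 'a \<Rightarrow> nat" where
  "load G nxt S0 t e = sent G nxt (state_at G nxt S0 t) e"

definition cumulative_load ::
    "('v, 'a) pre_digraph \<Rightarrow> ('a \<Rightarrow> 'a) \<Rightarrow> ('v, 'a) rotor_state \<Rightarrow> nat \<Rightarrow> nat \<Rightarrow> 'a \<Rightarrow> nat" where
  "cumulative_load G nxt S0 t1 t2 e = (\<Sum>t\<in>{t1..<t2}. load G nxt S0 t e)"

definition potential ::
    "('v, 'a) pre_digraph \<Rightarrow> ('a \<Rightarrow> 'a) \<Rightarrow> ('v, 'a) rotor_state \<Rightarrow> nat \<Rightarrow> nat \<Rightarrow> nat" where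
  "potential G nxt S0 i t = (\<Sum>e\<in>arcs G. (cumulative_load G nxt S0 t (t + i) e)\<^sup>2)"

end

theory Submission
  imports Defs
begin

text \<open>A rotor sends tokens along the outgoing arcs of a vertex as evenly as possible in every time
  window, so, the in-degree being the out-degree, every potential is nonincreasing in time and stays
  constant in a step only if the tokens also arrived evenly on the incoming arcs in the window
  considered. If all windows within a time span \<open>[T, T + W]\<close> are even, then the incoming and the
  outgoing arcs of each vertex can be matched such that the loads of the incoming arcs are repeated one
  step later by their partners. The matching permutes the \<open>2m\<close> arcs; hence the load of an arc has
  within this span the length of its cycle as a period, and the periods \<open>p\<close>, \<open>q\<close> of two arcs are
  equal or \<open>p + q \<le> 2m\<close>.

  Equality of the sums of potentials gives evenness for the windows of length at most \<open>3m\<close> beginning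
  in \<open>[T, T + 2m\<^sup>2)\<close>. Evenness of all windows in \<open>[T, T + W]\<close> extends to \<open>W + 1\<close>. Let \<open>D\<close> be the
  difference of the cumulative loads of two arcs into the same vertex, and suppose it violates
  evenness at time \<open>T + W + 1\<close>. For \<open>W < 2m\<^sup>2\<close>, \<open>D\<close> must have been constant for the last \<open>3m - 1\<close>
  steps, so the two loads agreed there, and by Fine and Wilf they agreed ever since \<open>T\<close>, so that
  \<open>D\<close> vanished. For \<open>W \<ge> 2m\<^sup>2\<close>, \<open>D\<close> has a positive drift over a common period of at most \<open>m\<^sup>2\<close>, so
  it increased by at least \<open>2\<close> over two such periods within the span. Therefore all windows after
  \<open>T\<close> are even, and the loads are periodic from \<open>T\<close> on.\<close>

section \<open>Balanced distributions\<close>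

lemma sum_shifted_squares:
  fixes x :: "'a \<Rightarrow> nat" and c :: int
  shows "(\<Sum>a\<in>A. (int (x a) - c) * (int (x a) - c - 1))
    = int (\<Sum>a\<in>A. (x a)\<^sup>2) - (2 * c + 1) * int (sum x A) + int (card A) * (c * (c + 1))"
proof -
  have "(\<Sum>a\<in>A. (int (x a) - c) * (int (x a) - c - 1))
      = (\<Sum>a\<in>A. int ((x a)\<^sup>2) - (2 * c + 1) * int (x a) + c * (c + 1))"
    by (rule sum.cong) (simp_all add: power2_eq_square algebra_simps)
  then show ?thesis
    by (simp add: sum.distrib sum_subtractf sum_distrib_left)
qed

lemma consecutive_product:
  fixes z c :: int
  shows "0 \<le> (z - c) * (z - c - 1)"
    and "(z - c) * (z - c - 1) = 0 \<longleftrightarrow> z = c \<or> z = c + 1"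
proof -
  show "0 \<le> (z - c) * (z - c - 1)"
    by (cases "z \<le> c") (simp_all add: mult_nonpos_nonpos)
qed auto

text \<open>For a fixed size and total, sums of squares differ exactly as the sums of
  \<open>(z - c) * (z - c - 1)\<close>. These terms are nonnegative on integers and vanish only at
  \<open>c\<close> and \<open>c + 1\<close>, so with \<open>c\<close> the minimum of the balanced
  \<open>y\<close> the sum for \<open>y\<close> is 0.\<close>

lemma sum_squares_balanced:
  fixes x :: "'a \<Rightarrow> nat" and y :: "'b \<Rightarrow> nat"
  assumes fin: "finite A" "finite B" and card: "card A = card B" and sums: "sum x A = sum y B"
    and balanced: "\<And>b b'. b \<in> B \<Longrightarrow> b' \<in> B \<Longrightarrow> y b \<le> y b' + 1"
  shows "(\<Sum>b\<in>B. (y b)\<^sup>2) \<le> (\<Sum>a\<in>A. (x a)\<^sup>2)"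
    and "(\<Sum>b\<in>B. (y b)\<^sup>2) = (\<Sum>a\<in>A. (x a)\<^sup>2) \<Longrightarrow> a \<in> A \<Longrightarrow> a' \<in> A \<Longrightarrow> x a \<le> x a' + 1"
proof -
  define c where "c = int (Min (y ` B))"
  have "(\<Sum>b\<in>B. (int (y b) - c) * (int (y b) - c - 1)) = 0"
  proof (rule sum.neutral, rule ballI)
    fix b assume b: "b \<in> B"
    have "Min (y ` B) \<in> y ` B"
      using b fin by (intro Min_in) auto
    then have "y b \<le> Min (y ` B) + 1"
      using balanced b by auto
    moreover have "Min (y ` B) \<le> y b"
      using b fin by simp
    ultimately have "int (y b) = c \<or> int (y b) = c + 1"
      by (auto simp: c_def)
    then show "(int (y b) - c) * (int (y b) - c - 1) = 0"
      by auto
  qed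
  then have gap: "(\<Sum>a\<in>A. (int (x a) - c) * (int (x a) - c - 1))
      = int (\<Sum>a\<in>A. (x a)\<^sup>2) - int (\<Sum>b\<in>B. (y b)\<^sup>2)"
    unfolding sum_shifted_squares by (simp only: card sums)
  have nonneg: "0 \<le> (int (x a) - c) * (int (x a) - c - 1)" for a
    by (rule consecutive_product)
  then have "0 \<le> (\<Sum>a\<in>A. (int (x a) - c) * (int (x a) - c - 1))"
    by (intro sum_nonneg)
  then show "(\<Sum>b\<in>B. (y b)\<^sup>2) \<le> (\<Sum>a\<in>A. (x a)\<^sup>2)"
    unfolding gap by linarith
  assume "(\<Sum>b\<in>B. (y b)\<^sup>2) = (\<Sum>a\<in>A. (x a)\<^sup>2)" and a: "a \<in> A" "a' \<in> A"
  then have "(\<Sum>a\<in>A. (int (x a) - c) * (int (x a) - c - 1)) = 0"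
    unfolding gap by simp
  then have "\<forall>a\<in>A. (int (x a) - c) * (int (x a) - c - 1) = 0"
    using sum_nonneg_eq_0_iff[OF fin(1) nonneg] by simp
  then have "int (x b) = c \<or> int (x b) = c + 1" if "b \<in> A" for b
    using that unfolding consecutive_product(2) by blast
  from this[OF a(1)] this[OF a(2)] show "x a \<le> x a' + 1"
    by linarith
qed

section \<open>Matching families by rank\<close>

lemma balanced_maximum_unique:
  fixes x :: "'a \<Rightarrow> nat" and y :: "'b \<Rightarrow> nat"
  assumes "finite A" "finite B" "card A = card B" "sum x A = sum y B" "a \<in> A" "b \<in> B"
    and A: "\<And>a'. a' \<in> A \<Longrightarrow> x a' \<le> x a \<and> x a \<le> x a' + 1"
    and B: "\<And>b'. b' \<in> B \<Longrightarrow> y b' \<le> y b \<and> y b \<le> y b' + 1"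
  shows "x a = y b"
proof -
  have le: "u i \<le> w j"
    if "finite I" "finite J" "card I = card J" "sum u I = sum w J" "i \<in> I" "j \<in> J"
      and I: "\<And>i'. i' \<in> I \<Longrightarrow> u i' \<le> u i \<and> u i \<le> u i' + 1"
      and J: "\<And>j'. j' \<in> J \<Longrightarrow> w j' \<le> w j \<and> w j \<le> w j' + 1"
    for I :: "'c set" and J :: "'d set" and u :: "'c \<Rightarrow> nat" and w :: "'d \<Rightarrow> nat" and i j
  proof (rule ccontr)
    assume *: "\<not> u i \<le> w j"
    \<comment> \<open>If the maximum \<open>u i\<close> exceeded \<open>w j\<close>, all of
      \<open>u\<close> would be at least \<open>w j\<close> and \<open>u i\<close> even larger, so
      the total of \<open>u\<close> would be too big.\<close>
    have "sum w J \<le> (\<Sum>j'\<in>J. w j)"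
      using J by (intro sum_mono) blast
    also have "\<dots> = (\<Sum>i'\<in>I. w j)"
      by (simp add: that)
    also have "\<dots> < sum u I"
      using * I that by (intro sum_strict_mono_ex1 bexI[of _ i]) fastforce+
    finally show False
      using that by simp
  qed
  show ?thesis
    by (intro antisym le[of A B x y] le[of B A y x]) (use assms in auto)
qed

text \<open>The difference of two members varies by at most 1 over time, so it is impossible that
  one leads strictly at one time and the other at another. The members are thus consistently
  ordered, and one with the largest sum over all times leads throughout.\<close>

lemma balanced_family_maximum:
  fixes x :: "nat \<Rightarrow> 'a \<Rightarrow> nat"
  assumes "finite A" "A \<noteq> {}"
    and start: "\<And>a. a \<in> A \<Longrightarrow> x 0 a = 0"
    and balanced: "\<And>a b s t. a \<in> A \<Longrightarrow> b \<in> A \<Longrightarrow> s \<le> t \<Longrightarrow> t \<le> W \<Longrightarrow> x t a + x s b \<le> x t b + x s a + 1"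
  obtains a where "a \<in> A" "\<And>t b. t \<le> W \<Longrightarrow> b \<in> A \<Longrightarrow> x t b \<le> x t a \<and> x t a \<le> x t b + 1"
proof -
  define key where "key a = (\<Sum>t\<le>W. x t a)" for a
  have "Max (key ` A) \<in> key ` A"
    using assms by (intro Max_in) auto
  then obtain a where a: "a \<in> A" "key a = Max (key ` A)"
    by auto
  have "x t b \<le> x t a" if t: "t \<le> W" and b: "b \<in> A" for t b
  proof (rule ccontr)
    assume t': "\<not> x t b \<le> x t a"
    have "key a < key b"
      unfolding key_def
    proof (rule sum_strict_mono_ex1)
      show "\<forall>s\<in>{..W}. x s a \<le> x s b"
      proof (rule ballI, rule ccontr)
        fix s assume "s \<in> {..W}" "\<not> x s a \<le> x s b"
        then show False
          using t t' balanced[of b a s t] balanced[of a b t s] a b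
          by (cases "s \<le> t") auto
      qed
      show "\<exists>s\<in>{..W}. x s a < x s b"
        using t t' by (intro bexI[of _ t]) auto
    qed simp
    moreover have "key b \<le> key a"
      using a b \<open>finite A\<close> by simp
    ultimately show False
      by simp
  qed
  moreover have "x t a \<le> x t b + 1" if "t \<le> W" "b \<in> A" for t b
    using balanced[of a b 0 t] that a start by simp
  ultimately show thesis
    using that a by blast
qed

text \<open>Induction removing a leading member from each side: size and total determine the maximum
  at each time, so the two leaders agree throughout, and the remaining families satisfy the
  hypotheses again.\<close>

lemma balanced_families_bij:
  fixes x :: "nat \<Rightarrow> 'a \<Rightarrow> nat" and y :: "nat \<Rightarrow> 'b \<Rightarrow> nat"
  assumes "finite A" "finite B" "card A = card B"
    and "\<And>t. t \<le> W \<Longrightarrow> sum (x t) A = sum (y t) B"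
    and "\<And>a. a \<in> A \<Longrightarrow> x 0 a = 0" "\<And>b. b \<in> B \<Longrightarrow> y 0 b = 0"
    and "\<And>a b s t. a \<in> A \<Longrightarrow> b \<in> A \<Longrightarrow> s \<le> t \<Longrightarrow> t \<le> W \<Longrightarrow> x t a + x s b \<le> x t b + x s a + 1"
    and "\<And>a b s t. a \<in> B \<Longrightarrow> b \<in> B \<Longrightarrow> s \<le> t \<Longrightarrow> t \<le> W \<Longrightarrow> y t a + y s b \<le> y t b + y s a + 1"
  shows "\<exists>h. bij_betw h A B \<and> (\<forall>a\<in>A. \<forall>t\<le>W. x t a = y t (h a))"
  using assms
proof (induction "card A" arbitrary: A B)
  case 0
  then show ?case
    by (auto simp: bij_betw_def)
next
  case (Suc n)
  have ne: "A \<noteq> {}" "B \<noteq> {}"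
    using Suc.hyps(2) Suc.prems(3) by auto
  obtain a where a: "a \<in> A"
    and amax: "\<And>t b. t \<le> W \<Longrightarrow> b \<in> A \<Longrightarrow> x t b \<le> x t a \<and> x t a \<le> x t b + 1"
    by (rule balanced_family_maximum[of A x W]) (use Suc.prems ne in auto)
  obtain b where b: "b \<in> B"
    and bmax: "\<And>t b'. t \<le> W \<Longrightarrow> b' \<in> B \<Longrightarrow> y t b' \<le> y t b \<and> y t b \<le> y t b' + 1"
    by (rule balanced_family_maximum[of B y W]) (use Suc.prems ne in auto)
  have eq: "x t a = y t b" if "t \<le> W" for t
    by (rule balanced_maximum_unique[of A B "x t" "y t"])
      (use Suc.prems a b amax[OF that] bmax[OF that] that in auto)
  have "\<exists>h. bij_betw h (A - {a}) (B - {b}) \<and> (\<forall>a\<in>A - {a}. \<forall>t\<le>W. x t a = y t (h a))"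
  proof (rule Suc.hyps(1))
    show "n = card (A - {a})" "card (A - {a}) = card (B - {b})"
      using Suc.hyps(2) Suc.prems(1-3) a b by auto
    show "sum (x t) (A - {a}) = sum (y t) (B - {b})" if "t \<le> W" for t
      using Suc.prems(1,2) a b eq[OF that] Suc.prems(4)[OF that]
      by (simp add: sum_diff1_nat)
  qed (use Suc.prems in auto)
  then obtain h where h: "bij_betw h (A - {a}) (B - {b})"
    "\<And>a' t. a' \<in> A - {a} \<Longrightarrow> t \<le> W \<Longrightarrow> x t a' = y t (h a')"
    by blast
  have "bij_betw (h(a := b)) (insert a (A - {a})) (insert b (B - {b}))"
    using h(1) by (auto simp: bij_betw_def inj_on_def)
  then have "bij_betw (h(a := b)) A B"
    using a b by (simp add: insert_absorb)
  moreover have "\<forall>a'\<in>A. \<forall>t\<le>W. x t a' = y t ((h(a := b)) a')"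
    using h(2) eq by auto
  ultimately show ?case
    by blast
qed

section \<open>Residue classes and cycles\<close>

lemma card_arith_progression_le:
  fixes n r r' X :: nat
  assumes "r' < n"
  shows "card {j. j < X \<and> j mod n = r} \<le> card {j. j < X \<and> j mod n = r'} + 1"
proof -
  have bij: "card {j. j < X \<and> j mod n = s} = card {a. a * n + s < X}" if "s < n" for s
  proof (rule bij_betw_same_card[symmetric])
    show "bij_betw (\<lambda>a. a * n + s) {a. a * n + s < X} {j. j < X \<and> j mod n = s}"
      using that by (intro bij_betw_byWitness[of _ "\<lambda>j. j div n"]) auto
  qed
  have fin: "finite {a. a * n + r' < X}"
  proof (rule finite_subset)
    show "{a. a * n + r' < X} \<subseteq> {..X}"
    proof safe
      fix a assume "a * n + r' < X"
      moreover have "a \<le> a * n"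
        using assms by (cases n) auto
      ultimately show "a \<le> X"
        by linarith
    qed
  qed simp
  show ?thesis
  proof (cases "r < n")
    case True
    \<comment> \<open>Except for the first, each visit to residue \<open>r\<close> is preceded by
      the visit to \<open>r'\<close> in the previous block of length \<open>n\<close>.\<close>
    have "{a. a * n + r < X} \<subseteq> insert 0 (Suc ` {a. a * n + r' < X})"
    proof
      fix a assume "a \<in> {a. a * n + r < X}"
      then show "a \<in> insert 0 (Suc ` {a. a * n + r' < X})"
        using assms by (cases a) auto
    qed
    then have "card {a. a * n + r < X} \<le> card (insert 0 (Suc ` {a. a * n + r' < X}))"
      using fin by (intro card_mono) auto
    also have "\<dots> \<le> card {a. a * n + r' < X} + 1"
      using fin by (simp add: card_insert_if card_image)
    finally show ?thesis
      using bij True assms by simp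
  next
    case False
    then have none: "{j. j < X \<and> j mod n = r} = {}"
      using assms by auto
    show ?thesis
      unfolding none by simp
  qed
qed

lemma funpow_cycle_length:
  assumes "x \<in> orbit f x"
  shows "card (orbit f x) > 0" "(f ^^ card (orbit f x)) x = x"
    "\<And>y. y \<in> orbit f x \<Longrightarrow> \<exists>r < card (orbit f x). \<forall>j. (f ^^ j) x = y \<longleftrightarrow> j mod card (orbit f x) = r"
proof -
  define n where "n = funpow_dist1 f x x"
  have orb: "orbit f x = (\<lambda>n. (f ^^ n) x) ` {0..<n}"
    and inj: "inj_on (\<lambda>n. (f ^^ n) x) {0..<n}" and self: "(f ^^ n) x = x" and "n > 0"
    using orbit_conv_funpow_dist1[OF assms] inj_on_funpow_dist1[OF assms]
      funpow_dist1_prop[OF assms] by (simp_all add: n_def)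
  have card: "card (orbit f x) = n"
    unfolding orb using inj by (simp add: card_image)
  show "card (orbit f x) > 0" "(f ^^ card (orbit f x)) x = x"
    using self \<open>n > 0\<close> by (simp_all add: card)
  fix y assume "y \<in> orbit f x"
  then obtain r where r: "r < n" "y = (f ^^ r) x"
    unfolding orb by auto
  have "(f ^^ j) x = y \<longleftrightarrow> j mod n = r" for j
  proof -
    have "(f ^^ j) x = (f ^^ (j mod n)) x"
      using funpow_mod_eq[OF self] by simp
    moreover have "j mod n < n"
      using \<open>n > 0\<close> by simp
    ultimately show ?thesis
      using inj_onD[OF inj, of "j mod n" r] r by auto
  qed
  then show "\<exists>r < card (orbit f x). \<forall>j. (f ^^ j) x = y \<longleftrightarrow> j mod card (orbit f x) = r"
    using r by (auto simp: card)
qed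

text \<open>The Fine--Wilf theorem, without the gcd improvement on the length of the overlap.\<close>

lemma periodic_agree_backwards:
  fixes a b :: "nat \<Rightarrow> 'c"
  assumes "\<And>t. t + p \<le> W \<Longrightarrow> a (t + p) = a t" "\<And>t. t + q \<le> W \<Longrightarrow> b (t + q) = b t"
    and "p > 0" "q > 0" and pq: "p = q \<and> p \<le> n \<or> p + q \<le> n"
    and "s + n \<le> W + 1" "\<And>t. s \<le> t \<Longrightarrow> t < s + n \<Longrightarrow> a t = b t" and "t < s"
  shows "a t = b t"
  using assms(6-8)
proof (induction s)
  case (Suc s)
  note agree = Suc.prems(2) and period = assms(1,2)
  have s: "a s = b s"
  proof (cases "p = q")
    case True
    then show ?thesis
      using period[of s] agree[of "s + p"] pq \<open>p > 0\<close> Suc.prems(1) by auto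
  next
    case False
    then have "p + q \<le> n"
      using pq by simp
    \<comment> \<open>\<open>a s = a (s + p) = b (s + p) = b (s + p + q) = a (s + p + q) = a (s + q)
      = b (s + q) = b s\<close>.\<close>
    then show ?thesis
      using period[of s] period(1)[of "s + q"] period(2)[of "s + p"]
        agree[of "s + p"] agree[of "s + q"] agree[of "s + (p + q)"] assms(3,4) Suc.prems(1)
      by (simp add: ac_simps)
  qed
  show ?case
  proof (cases "t = s")
    case False
    show ?thesis
    proof (rule Suc.IH)
      fix u assume "s \<le> u" "u < s + n"
      then show "a u = b u"
        using s agree[of u] by (cases "u = s") auto
    qed (use False Suc.prems in auto)
  qed (use s in simp)
qed simp

lemma periodic_mult:
  fixes a :: "nat \<Rightarrow> 'c" and p W :: nat
  assumes "\<And>t. t + p \<le> W \<Longrightarrow> a (t + p) = a t"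
  shows "t + k * p \<le> W \<Longrightarrow> a (t + k * p) = a t"
proof (induction k)
  case (Suc k)
  then show ?case
    using assms[of "t + k * p"] by (simp add: algebra_simps)
qed simp

lemma card_less_add:
  fixes X k :: nat
  shows "card {j. j < X + k \<and> P j} = card {j. j < X \<and> P j} + card {j. j < k \<and> P (X + j)}"
proof -
  have "{j. j < X + k \<and> P j} = {j. j < X \<and> P j} \<union> (+) X ` {j. j < k \<and> P (X + j)}"
  proof (intro set_eqI iffI)
    fix j assume "j \<in> {j. j < X + k \<and> P j}"
    then show "j \<in> {j. j < X \<and> P j} \<union> (+) X ` {j. j < k \<and> P (X + j)}"
      by (cases "j < X") (auto intro!: image_eqI[of _ _ "j - X"])
  qed auto
  then have "card {j. j < X + k \<and> P j}
      = card ({j. j < X \<and> P j} \<union> (+) X ` {j. j < k \<and> P (X + j)})"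
    by simp
  also have "\<dots> = card {j. j < X \<and> P j} + card ((+) X ` {j. j < k \<and> P (X + j)})"
    by (rule card_Un_disjoint) auto
  finally show ?thesis
    by (simp add: card_image)
qed

lemma funpow_funpow: "(f ^^ j) ((f ^^ k) x) = (f ^^ (k + j)) x"
  by (subst add.commute) (simp add: funpow_add)

section \<open>Flows leaving each vertex in balance\<close>

text \<open>Abstracts from pointers: what remains of a rotor system is conservation of tokens and
  evenness on the outgoing arcs in every window. Time will be counted from the \<open>T\<close> of
  the theorem, and \<open>energy\<close> will be the potential.\<close>

locale balanced_flow = fin_digraph G
  for G :: "('v, 'a) pre_digraph" +
  fixes L :: "nat \<Rightarrow> 'a \<Rightarrow> nat"
  assumes eulerian: "v \<in> verts G \<Longrightarrow> in_degree G v = out_degree G v"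
    and conservation: "v \<in> verts G \<Longrightarrow> (\<Sum>e\<in>out_arcs G v. L (Suc t) e) = (\<Sum>e\<in>in_arcs G v. L t e)"
    and out_balanced: "v \<in> verts G \<Longrightarrow> e \<in> out_arcs G v \<Longrightarrow> f \<in> out_arcs G v \<Longrightarrow>
      (\<Sum>u\<in>{s..<t}. L u e) \<le> (\<Sum>u\<in>{s..<t}. L u f) + 1"
begin

section \<open>Monotonicity of the potentials\<close>

definition flow :: "nat \<Rightarrow> nat \<Rightarrow> 'a \<Rightarrow> nat" where
  "flow s t e = (\<Sum>u\<in>{s..<t}. L u e)"

definition energy :: "nat \<Rightarrow> nat \<Rightarrow> nat" where
  "energy i t = (\<Sum>e\<in>arcs G. (flow t (t + i) e)\<^sup>2)"

lemma flow_split: "s \<le> t \<Longrightarrow> t \<le> u \<Longrightarrow> flow s u e = flow s t e + flow t u e"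
  by (simp add: flow_def sum.atLeastLessThan_concat)

lemma flow_conservation:
  assumes "v \<in> verts G"
  shows "(\<Sum>e\<in>out_arcs G v. flow (Suc s) (Suc t) e) = (\<Sum>e\<in>in_arcs G v. flow s t e)"
proof -
  have "(\<Sum>e\<in>out_arcs G v. flow (Suc s) (Suc t) e) = (\<Sum>u\<in>{s..<t}. \<Sum>e\<in>out_arcs G v. L (Suc u) e)"
    unfolding flow_def sum.shift_bounds_Suc_ivl by (rule sum.swap)
  also have "\<dots> = (\<Sum>u\<in>{s..<t}. \<Sum>e\<in>in_arcs G v. L u e)"
    using conservation[OF assms] by simp
  also have "\<dots> = (\<Sum>e\<in>in_arcs G v. flow s t e)"
    unfolding flow_def by (rule sum.swap)
  finally show ?thesis .
qed

lemma sum_arcs_by_head: "(\<Sum>e\<in>arcs G. g e) = (\<Sum>v\<in>verts G. \<Sum>e\<in>in_arcs G v. g e)"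
  unfolding in_arcs_def by (intro sum.group[symmetric]) auto

lemma sum_arcs_by_tail: "(\<Sum>e\<in>arcs G. g e) = (\<Sum>v\<in>verts G. \<Sum>e\<in>out_arcs G v. g e)"
  unfolding out_arcs_def by (intro sum.group[symmetric]) auto

text \<open>The flow out of \<open>v\<close> in the window one step later has the same total as the
  flow into \<open>v\<close>, is spread over equally many arcs and is balanced, so
  \<open>sum_squares_balanced\<close> applies.\<close>

lemma energy_at_vertex:
  assumes "v \<in> verts G"
  shows "(\<Sum>e\<in>out_arcs G v. (flow (Suc s) (Suc t) e)\<^sup>2) \<le> (\<Sum>e\<in>in_arcs G v. (flow s t e)\<^sup>2)"
    and "(\<Sum>e\<in>out_arcs G v. (flow (Suc s) (Suc t) e)\<^sup>2) = (\<Sum>e\<in>in_arcs G v. (flow s t e)\<^sup>2) \<Longrightarrow>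
      e \<in> in_arcs G v \<Longrightarrow> f \<in> in_arcs G v \<Longrightarrow> flow s t e \<le> flow s t f + 1"
proof -
  have "finite (in_arcs G v)" "finite (out_arcs G v)" "card (in_arcs G v) = card (out_arcs G v)"
    using eulerian[OF assms] by (auto simp: in_degree_def out_degree_def)
  note * = sum_squares_balanced[OF this flow_conservation[OF assms, symmetric]
      out_balanced[OF assms, folded flow_def]]
  show "(\<Sum>e\<in>out_arcs G v. (flow (Suc s) (Suc t) e)\<^sup>2) \<le> (\<Sum>e\<in>in_arcs G v. (flow s t e)\<^sup>2)"
    by (rule *)
  show "(\<Sum>e\<in>out_arcs G v. (flow (Suc s) (Suc t) e)\<^sup>2) = (\<Sum>e\<in>in_arcs G v. (flow s t e)\<^sup>2) \<Longrightarrow>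
      e \<in> in_arcs G v \<Longrightarrow> f \<in> in_arcs G v \<Longrightarrow> flow s t e \<le> flow s t f + 1"
    by (rule *)
qed

lemma energy_Suc_le: "energy i (Suc t) \<le> energy i t"
proof -
  have "energy i (Suc t) = (\<Sum>v\<in>verts G. \<Sum>e\<in>out_arcs G v. (flow (Suc t) (Suc (t + i)) e)\<^sup>2)"
    by (simp add: energy_def sum_arcs_by_tail)
  also have "\<dots> \<le> (\<Sum>v\<in>verts G. \<Sum>e\<in>in_arcs G v. (flow t (t + i) e)\<^sup>2)"
    by (intro sum_mono energy_at_vertex)
  also have "\<dots> = energy i t"
    by (simp add: energy_def sum_arcs_by_head)
  finally show ?thesis .
qed

lemma energy_antimono: "s \<le> t \<Longrightarrow> energy i t \<le> energy i s"
  using energy_Suc_le by (rule lift_Suc_antimono_le)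

text \<open>No vertex term can increase, so constancy of their sum forces equality at each
  vertex.\<close>

lemma in_balanced_if_energy_eq:
  assumes "energy i (Suc t) = energy i t" "e \<in> arcs G" "f \<in> arcs G" "head G e = head G f"
  shows "flow t (t + i) e \<le> flow t (t + i) f + 1"
proof -
  have "(\<Sum>v\<in>verts G. \<Sum>e\<in>out_arcs G v. (flow (Suc t) (Suc (t + i)) e)\<^sup>2)
      = (\<Sum>v\<in>verts G. \<Sum>e\<in>in_arcs G v. (flow t (t + i) e)\<^sup>2)"
    using assms(1) by (simp add: energy_def flip: sum_arcs_by_tail sum_arcs_by_head)
  then have "(\<Sum>e\<in>out_arcs G (head G e). (flow (Suc t) (Suc (t + i)) e)\<^sup>2)
      = (\<Sum>e\<in>in_arcs G (head G e). (flow t (t + i) e)\<^sup>2)"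
    by (rule sum_mono_inv) (use assms(2) in \<open>auto intro: energy_at_vertex\<close>)
  then show ?thesis
    using assms by (intro energy_at_vertex(2)[of "head G e"]) auto
qed

section \<open>Matchings and periods in an even span\<close>

definition in_balanced_upto :: "nat \<Rightarrow> bool" where
  "in_balanced_upto W \<longleftrightarrow> (\<forall>e\<in>arcs G. \<forall>f\<in>arcs G. \<forall>s t. head G e = head G f \<longrightarrow> s \<le> t \<longrightarrow> t \<le> W
     \<longrightarrow> flow s t e \<le> flow s t f + 1)"

lemma in_balanced_uptoD:
  "in_balanced_upto W \<Longrightarrow> e \<in> arcs G \<Longrightarrow> f \<in> arcs G \<Longrightarrow> head G e = head G f \<Longrightarrow> s \<le> t \<Longrightarrow> t \<le> W
    \<Longrightarrow> flow s t e \<le> flow s t f + 1"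
  unfolding in_balanced_upto_def by blast

text \<open>With all windows balanced, both the incoming and the outgoing arcs of a vertex are linearly
  ordered by their cumulative loads throughout the span, and equal ranks mean equal loads.\<close>

lemma matching_at_vertex:
  assumes W: "in_balanced_upto W" and v: "v \<in> verts G"
  shows "\<exists>h. bij_betw h (in_arcs G v) (out_arcs G v) \<and>
    (\<forall>e\<in>in_arcs G v. \<forall>t<W. L (Suc t) (h e) = L t e)"
proof -
  \<comment> \<open>Tokens sent towards \<open>v\<close> in step \<open>t\<close> leave it in step
    \<open>Suc t\<close>, hence the outgoing flow is counted from 1.\<close>
  have "\<exists>h. bij_betw h (in_arcs G v) (out_arcs G v) \<and>
    (\<forall>e\<in>in_arcs G v. \<forall>t\<le>W. flow 0 t e = flow 1 (Suc t) (h e))"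
  proof (rule balanced_families_bij)
    show "card (in_arcs G v) = card (out_arcs G v)"
      using eulerian[OF v] by (simp add: in_degree_def out_degree_def)
    show "sum (flow 0 t) (in_arcs G v) = sum (flow 1 (Suc t)) (out_arcs G v)" for t
      using flow_conservation[OF v, of 0 t] by simp
    show "flow 0 t e + flow 0 s f \<le> flow 0 t f + flow 0 s e + 1"
      if "e \<in> in_arcs G v" "f \<in> in_arcs G v" "s \<le> t" "t \<le> W" for e f s t
      using that in_balanced_uptoD[OF W, of e f s t]
        flow_split[of 0 s t e] flow_split[of 0 s t f] by simp
    show "flow 1 (Suc t) e + flow 1 (Suc s) f \<le> flow 1 (Suc t) f + flow 1 (Suc s) e + 1"
      if "e \<in> out_arcs G v" "f \<in> out_arcs G v" "s \<le> t" "t \<le> W" for e f s t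
      using that out_balanced[OF v, of e f "Suc s" "Suc t", folded flow_def]
        flow_split[of 1 "Suc s" "Suc t" e] flow_split[of 1 "Suc s" "Suc t" f] by simp
  qed (auto simp: flow_def)
  then obtain h where h: "bij_betw h (in_arcs G v) (out_arcs G v)"
    "\<And>e t. e \<in> in_arcs G v \<Longrightarrow> t \<le> W \<Longrightarrow> flow 0 t e = flow 1 (Suc t) (h e)"
    by blast
  have "L (Suc t) (h e) = L t e" if "e \<in> in_arcs G v" "t < W" for e t
    using h(2)[OF that(1), of t] h(2)[OF that(1), of "Suc t"] that(2)
    by (simp add: flow_def)
  with h(1) show ?thesis
    by blast
qed

text \<open>The matchings at the vertices glue to a permutation: the image of an arc leaves the head
  of that arc and so reveals at which vertex it was matched.\<close>

lemma matching:
  assumes "in_balanced_upto W"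
  obtains \<mu> where "bij_betw \<mu> (arcs G) (arcs G)"
    "\<And>e t. e \<in> arcs G \<Longrightarrow> t < W \<Longrightarrow> L (Suc t) (\<mu> e) = L t e"
proof -
  have "\<forall>v\<in>verts G. \<exists>h. bij_betw h (in_arcs G v) (out_arcs G v) \<and>
    (\<forall>e\<in>in_arcs G v. \<forall>t<W. L (Suc t) (h e) = L t e)"
    using matching_at_vertex[OF assms] by blast
  then obtain h where "\<forall>v\<in>verts G. bij_betw (h v) (in_arcs G v) (out_arcs G v) \<and>
    (\<forall>e\<in>in_arcs G v. \<forall>t<W. L (Suc t) (h v e) = L t e)"
    by metis
  then have bij: "bij_betw (h v) (in_arcs G v) (out_arcs G v)"
    and shift: "e \<in> in_arcs G v \<Longrightarrow> t < W \<Longrightarrow> L (Suc t) (h v e) = L t e" if "v \<in> verts G" for v e t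
    using that by blast+
  define \<mu> where "\<mu> e = h (head G e) e" for e
  have out: "\<mu> e \<in> out_arcs G (head G e)" if "e \<in> arcs G" for e
    using bij[of "head G e"] that unfolding \<mu>_def by (auto dest: bij_betwE)
  have "inj_on \<mu> (arcs G)"
  proof (rule inj_onI)
    fix e f assume ef: "e \<in> arcs G" "f \<in> arcs G" "\<mu> e = \<mu> f"
    then have "head G e = head G f"
      using out[of e] out[of f] by simp
    then show "e = f"
      using bij[of "head G e"] ef by (auto simp: \<mu>_def bij_betw_def dest: inj_onD)
  qed
  moreover have "\<mu> ` arcs G \<subseteq> arcs G"
    using out by auto
  ultimately have "bij_betw \<mu> (arcs G) (arcs G)"
    by (simp add: bij_betw_def endo_inj_surj)
  moreover have "L (Suc t) (\<mu> e) = L t e" if "e \<in> arcs G" "t < W" for e t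
    using shift[of "head G e" e t] that by (simp add: \<mu>_def)
  ultimately show thesis
    using that by blast
qed

text \<open>Following an arc once around its cycle under the matching brings its load back after as
  many steps as the cycle has arcs. Two cycles coincide or are disjoint, whence the bound on
  \<open>p e + p f\<close>. The periods may depend on \<open>W\<close>.\<close>

lemma local_periods:
  assumes "in_balanced_upto W"
  obtains p :: "'a \<Rightarrow> nat"
  where "\<And>e. e \<in> arcs G \<Longrightarrow> 0 < p e \<and> p e \<le> card (arcs G)"
    "\<And>e t. e \<in> arcs G \<Longrightarrow> t + p e \<le> W \<Longrightarrow> L (t + p e) e = L t e"
    "\<And>e f. e \<in> arcs G \<Longrightarrow> f \<in> arcs G \<Longrightarrow> p e = p f \<or> p e + p f \<le> card (arcs G)"
proof -
  obtain \<mu> where bij: "bij_betw \<mu> (arcs G) (arcs G)"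
    and shift: "\<And>e t. e \<in> arcs G \<Longrightarrow> t < W \<Longrightarrow> L (Suc t) (\<mu> e) = L t e"
    using matching[OF assms] by blast
  define \<pi> where "\<pi> = (\<lambda>e. if e \<in> arcs G then \<mu> e else e)"
  have perm: "\<pi> permutes arcs G"
  proof (rule bij_imp_permutes)
    have "bij_betw \<pi> (arcs G) (arcs G) = bij_betw \<mu> (arcs G) (arcs G)"
      by (rule bij_betw_cong) (simp add: \<pi>_def)
    with bij show "bij_betw \<pi> (arcs G) (arcs G)"
      by simp
  qed (simp add: \<pi>_def)
  then have permn: "permutation \<pi>"
    unfolding permutation_permutes using finite_arcs by blast
  define p where "p e = card (orbit \<pi> e)" for e
  note self = permutation_self_in_orbit[OF permn]
  have sub: "orbit \<pi> e \<subseteq> arcs G" if "e \<in> arcs G" for e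
    using permutes_orbit_subset[OF perm that] .
  have shift_funpow: "(\<pi> ^^ j) e \<in> arcs G \<and> (t + j \<le> W \<longrightarrow> L (t + j) ((\<pi> ^^ j) e) = L t e)"
    if "e \<in> arcs G" for e t j
  proof (induction j)
    case (Suc j)
    define g where "g = (\<pi> ^^ j) e"
    have g: "g \<in> arcs G" "\<pi> g \<in> arcs G"
      using Suc permutes_in_image[OF perm] by (simp_all add: g_def)
    moreover from g(1) have "\<pi> g = \<mu> g"
      by (simp add: \<pi>_def)
    ultimately show ?case
      using shift[of g "t + j"] Suc by (simp flip: g_def)
  qed (use that in simp)
  show thesis
  proof (rule that[of p])
    fix e assume e: "e \<in> arcs G"
    show "0 < p e \<and> p e \<le> card (arcs G)"
      using funpow_cycle_length(1)[OF self] card_mono[OF finite_arcs sub[OF e]] by (simp add: p_def)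
    show "L (t + p e) e = L t e" if "t + p e \<le> W" for t
      using shift_funpow[OF e, where t = t and j = "p e"] that funpow_cycle_length(2)[OF self, of e]
      by (simp add: p_def)
    fix f assume f: "f \<in> arcs G"
    show "p e = p f \<or> p e + p f \<le> card (arcs G)"
    proof (cases "orbit \<pi> e \<inter> orbit \<pi> f = {}")
      case True
      then have "p e + p f = card (orbit \<pi> e \<union> orbit \<pi> f)"
        unfolding p_def by (intro card_Un_disjoint[symmetric] finite_orbit self)
      also have "\<dots> \<le> card (arcs G)"
        using sub[OF e] sub[OF f] by (intro card_mono) auto
      finally show ?thesis by simp
    next
      case False
      then obtain g where "g \<in> orbit \<pi> e" "g \<in> orbit \<pi> f"
        by blast
      then have "orbit \<pi> e = orbit \<pi> f"
        using orbit_cyclic_eq3[OF cyclic_on_orbit'[OF permn]] by metis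
      then show ?thesis by (simp add: p_def)
    qed
  qed
qed

section \<open>Extending evenness by one time step\<close>

lemma in_balanced_upto_Suc:
  assumes card: "card (arcs G) = 2 * m"
    and multi: "\<And>e f. e \<in> arcs G \<Longrightarrow> f \<in> arcs G \<Longrightarrow> e \<noteq> f \<Longrightarrow> head G e = head G f \<Longrightarrow> 2 \<le> m"
    and short: "\<And>i t e f. i \<le> 3 * m \<Longrightarrow> t < 2 * m\<^sup>2 \<Longrightarrow> e \<in> arcs G \<Longrightarrow> f \<in> arcs G \<Longrightarrow>
      head G e = head G f \<Longrightarrow> flow t (t + i) e \<le> flow t (t + i) f + 1"
    and W: "in_balanced_upto W"
  shows "in_balanced_upto (Suc W)"
proof (rule ccontr)
  assume "\<not> in_balanced_upto (Suc W)"
  then obtain e f s t where ef: "e \<in> arcs G" "f \<in> arcs G" "head G e = head G f"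
    and st: "s \<le> t" "t \<le> Suc W" and gt: "\<not> flow s t e \<le> flow s t f + 1"
    by (auto simp: in_balanced_upto_def)
  have t: "t = Suc W"
    using in_balanced_uptoD[OF W ef, of s t] st gt by (cases "t \<le> W") auto
  have s: "s \<le> W"
    using gt st t by (cases "s = t") (auto simp: flow_def)
  \<comment> \<open>Only distinct arcs can violate evenness. The bound later yields
    \<open>2 * m \<le> m\<^sup>2\<close>.\<close>
  have m: "2 \<le> m"
    using multi[OF ef(1,2) _ ef(3)] gt by (cases "e = f") auto
  \<comment> \<open>An excess of \<open>e\<close> over \<open>f\<close> in a window is an increment
    of \<open>D\<close>. The violation is a rise by at least 2 from \<open>s\<close> to
    \<open>Suc W\<close>, whereas within the span \<open>D\<close> varies by at most 1.\<close>
  define D where "D u = int (flow 0 u e) - int (flow 0 u f)" for u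
  have D_diff: "int (flow u v e) - int (flow u v f) = D v - D u" if "u \<le> v" for u v
    using flow_split[of 0 u v e] flow_split[of 0 u v f] that by (simp add: D_def)
  have D_Suc: "D (Suc u) = D u + (int (L u e) - int (L u f))" for u
    by (simp add: D_def flow_def)
  have jump: "D (Suc W) \<ge> D s + 2"
    using D_diff[OF st(1)] gt t by simp
  have D_le: "D v \<le> D u + 1" if "u \<le> W" "v \<le> W" for u v
  proof (cases "u \<le> v")
    case True
    then show ?thesis
      using in_balanced_uptoD[OF W ef, of u v] D_diff[of u v] that by simp
  next
    case False
    then show ?thesis
      using in_balanced_uptoD[OF W ef(2,1) ef(3)[symmetric], of v u] D_diff[of v u] that by simp
  qed
  obtain p where p: "\<And>e. e \<in> arcs G \<Longrightarrow> 0 < p e \<and> p e \<le> card (arcs G)"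
    and period: "\<And>e t. e \<in> arcs G \<Longrightarrow> t + p e \<le> W \<Longrightarrow> L (t + p e) e = L t e"
    and pp: "\<And>e f. e \<in> arcs G \<Longrightarrow> f \<in> arcs G \<Longrightarrow> p e = p f \<or> p e + p f \<le> card (arcs G)"
    using local_periods[OF W] by blast
  show False
  proof (cases "W < 2 * m\<^sup>2")
    case True
    \<comment> \<open>The window from \<open>u\<close> to \<open>Suc W\<close> has length at most
      \<open>3 * m\<close> and starts before \<open>2 * m\<^sup>2\<close>, so by
      \<open>short\<close> it contributes at most 1 to the rise; the other 1 must have occurred by
      time \<open>u\<close>.\<close>
    have const: "D u = D s + 1" if "u \<le> W" "Suc W \<le> u + 3 * m" for u
    proof -
      have "flow u (Suc W) e \<le> flow u (Suc W) f + 1"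
        using short[of "Suc W - u" u e f] ef that True by simp
      then show ?thesis
        using D_diff[of u "Suc W"] D_le[of s u] jump that s by simp
    qed
    \<comment> \<open>Otherwise \<open>const\<close> at \<open>s\<close> itself would be absurd.
      Hence the subtraction in \<open>a\<close> is not truncated.\<close>
    have long: "s + 3 * m < Suc W"
      using const[of s] s by linarith
    define a where "a = Suc W - 3 * m"
    \<comment> \<open>\<open>D\<close> is constant over the last \<open>3 * m - 1\<close> steps
      before \<open>W\<close>, of which \<open>2 * m\<close> suffice for
      \<open>periodic_agree_backwards\<close>.\<close>
    have late: "L u e = L u f" if "a \<le> u" "u < W" for u
      using const[of u] const[of "Suc u"] D_Suc[of u] that long by (simp add: a_def)
    have "L u e = L u f" if "u < W" for u
    proof (cases "a \<le> u")
      case False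
      show ?thesis
      proof (rule periodic_agree_backwards[where a = "\<lambda>u. L u e" and b = "\<lambda>u. L u f"
            and p = "p e" and q = "p f" and n = "2 * m" and s = a])
        show "p e = p f \<and> p e \<le> 2 * m \<or> p e + p f \<le> 2 * m"
          using p[OF ef(1)] pp[OF ef(1,2)] card by auto
        show "a + 2 * m \<le> W + 1"
          using long by (simp add: a_def)
        show "L u e = L u f" if "a \<le> u" "u < a + 2 * m" for u
          using late[of u] that long m by (simp add: a_def)
      qed (use p period ef False in auto)
    qed (use late that in auto)
    then have "D u = 0" if "u \<le> W" for u
      using that by (simp add: D_def flow_def)
    then show False
      using const[of W] s m by simp
  next
    case False
    \<comment> \<open>A common period: equal periods are at most
      \<open>2 * m \<le> m\<^sup>2\<close>; otherwise the product is bounded by the inequality of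
      arithmetic and geometric means.\<close>
    obtain N where N: "0 < N" "N \<le> m\<^sup>2" "p e dvd N" "p f dvd N"
    proof (cases "p e = p f")
      case True
      have "p e \<le> m\<^sup>2"
        using p[OF ef(1)] card mult_le_mono1[OF m, of m] by (metis order_trans power2_eq_square)
      then show ?thesis
        using that[of "p e"] p[OF ef(1)] True by simp
    next
      case neq: False
      then have "p e + p f \<le> 2 * m"
        using pp[OF ef(1,2)] card by simp
      then have "(p e + p f)\<^sup>2 \<le> (2 * m)\<^sup>2"
        by (rule power_mono) simp
      moreover have "int (4 * (p e * p f)) \<le> int ((p e + p f)\<^sup>2)"
        using zero_le_power2[of "int (p e) - int (p f)"]
        by (simp add: power2_eq_square algebra_simps)
      then have "4 * (p e * p f) \<le> (p e + p f)\<^sup>2"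
        by (simp only: of_nat_le_iff)
      ultimately have "p e * p f \<le> m\<^sup>2"
        by (simp add: power_mult_distrib)
      then show ?thesis
        using that[of "p e * p f"] p[OF ef(1)] p[OF ef(2)] by simp
    qed
    have N_period: "L (u + N) g = L u g" if "g \<in> {e, f}" "u + N \<le> W" for u g
    proof -
      have "p g dvd N" "g \<in> arcs G"
        using that(1) N ef by auto
      then obtain k where k: "N = k * p g"
        by (metis dvdE mult.commute)
      show ?thesis
        using periodic_mult[where a = "\<lambda>u. L u g" and p = "p g" and W = W, OF period[OF \<open>g \<in> arcs G\<close>], where t = u and k = k]
          that(2) k by simp
    qed
    \<comment> \<open>The change of \<open>D\<close> over \<open>N\<close> steps does not depend on
      the start. This includes windows ending at \<open>Suc W\<close>, which involve loads at times
      up to \<open>W\<close> only.\<close>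
    have drift_0: "D (u + N) - D u = D (0 + N) - D 0" if "u + N \<le> Suc W" for u
      using that
    proof (induction u)
      case (Suc u)
      then show ?case
        using D_Suc[of u] D_Suc[of "u + N"] N_period[of e u] N_period[of f u] by simp
    qed simp
    \<comment> \<open>The reason for \<open>2 * m\<^sup>2\<close>: two common periods fit into the
      span, and a rise in each contradicts \<open>D_le\<close>.\<close>
    have W2: "2 * N \<le> W"
      using False N(2) by simp
    have drift: "D (u + N) - D u = D (Suc W) - D (Suc W - N)" if "u + N \<le> Suc W" for u
      using drift_0[OF that] drift_0[of "Suc W - N"] W2 by simp
    \<comment> \<open>\<open>Suc W - N\<close> lies in the span, so at least 1 of the rise falls
      into the last \<open>N\<close> steps and, by \<open>drift\<close>, into any \<open>N\<close>
      steps.\<close>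
    have "D (Suc W - N) \<le> D s + 1"
      using D_le[of s "Suc W - N"] s N(1) by simp
    then have up: "D (u + N) \<ge> D u + 1" if "u + N \<le> Suc W" for u
      using drift[OF that] jump by linarith
    have "D W \<ge> D (W - N) + 1"
      using up[of "W - N"] W2 by simp
    moreover have "D (W - N) \<ge> D (W - 2 * N) + 1"
      using up[of "W - 2 * N"] W2 by (simp add: numeral_2_eq_2)
    ultimately show False
      using D_le[of "W - 2 * N" W] by simp
  qed
qed

text \<open>The period found may change with the span, but it is at most the number of arcs, so the
  factorial is a multiple of it for every span.\<close>

lemma load_periodic:
  assumes "\<And>W. in_balanced_upto W" "e \<in> arcs G"
  shows "L (t + fact (card (arcs G))) e = L t e"
proof -
  define P :: nat where "P = fact (card (arcs G))"
  obtain p where p: "0 < p" "p \<le> card (arcs G)"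
    and period: "\<And>u. u + p \<le> t + P \<Longrightarrow> L (u + p) e = L u e"
    using local_periods[OF assms(1)[of "t + P"]] assms(2) by metis
  then obtain k where "P = k * p"
    unfolding P_def by (metis dvd_fact dvdE mult.commute less_eq_Suc_le One_nat_def)
  then show ?thesis
    using periodic_mult[where a = "\<lambda>u. L u e", OF period, where t = t and k = k] by (simp add: P_def)
qed

end

section \<open>Rotor-router systems\<close>

locale rotor_router = fin_digraph G
  for G :: "('v, 'a) pre_digraph" +
  fixes nxt :: "'a \<Rightarrow> 'a" and S0 :: "('v, 'a) rotor_state"
  assumes eulerian: "v \<in> verts G \<Longrightarrow> in_degree G v = out_degree G v"
    and rotor_order: "rotor_order G nxt"
    and rotor_state_on: "rotor_state_on G S0"
begin

abbreviation "state \<equiv> state_at G nxt S0"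

section \<open>Rotors send evenly in every window\<close>

lemma out_arcs_eq_orbit:
  assumes "rotor_state_on G S" "v \<in> verts G"
  shows "out_arcs G v = orbit nxt (pointer S v)" "pointer S v \<in> orbit nxt (pointer S v)"
proof -
  have p: "pointer S v \<in> out_arcs G v"
    using assms unfolding rotor_state_on_def by blast
  then have "cyclic_on nxt (out_arcs G v)"
    using rotor_order assms(2) unfolding rotor_order_def by blast
  from orbit_cyclic_eq3[OF this p]
  show "out_arcs G v = orbit nxt (pointer S v)"
    by simp
  then show "pointer S v \<in> orbit nxt (pointer S v)"
    using p by simp
qed

lemma state_Suc: "state (Suc t) = rotor_step G nxt (state t)"
  by (simp add: state_at_def)

lemma state_add: "state (s + t) = (rotor_step G nxt ^^ t) (state s)"
  unfolding state_at_def by (subst add.commute) (simp add: funpow_add)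

lemma rotor_state_on_state: "rotor_state_on G (state t)"
proof (induction t)
  case 0
  then show ?case
    using rotor_state_on by (simp add: state_at_def)
next
  case (Suc t)
  have "in_arcs G v = {}" if "v \<notin> verts G" for v
    using that by auto
  moreover have "(nxt ^^ n) (pointer (state t) v) \<in> out_arcs G v" if "v \<in> verts G" for v n
    unfolding out_arcs_eq_orbit(1)[OF Suc that]
    by (intro funpow_in_orbit out_arcs_eq_orbit(2)[OF Suc that])
  ultimately show ?case
    unfolding state_Suc rotor_state_on_def rotor_step_def by simp
qed

lemmas out_arcs_state = out_arcs_eq_orbit[OF rotor_state_on_state]

lemma sum_load_out_arcs:
  assumes "v \<in> verts G"
  shows "(\<Sum>e\<in>out_arcs G v. load G nxt S0 t e) = tokens (state t) v"
proof -
  let ?g = "\<lambda>j. (nxt ^^ j) (pointer (state t) v)"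
  have "(\<Sum>e\<in>out_arcs G v. load G nxt S0 t e)
      = (\<Sum>e\<in>out_arcs G v. \<Sum>j\<in>{j \<in> {..<tokens (state t) v}. ?g j = e}. 1)"
    by (rule sum.cong) (auto simp: load_def sent_def)
  also have "\<dots> = (\<Sum>j\<in>{..<tokens (state t) v}. 1)"
  proof (rule sum.group)
    show "?g ` {..<tokens (state t) v} \<subseteq> out_arcs G v"
      unfolding out_arcs_state(1)[of v t, OF assms]
      using funpow_in_orbit[OF out_arcs_state(2)[of v t, OF assms]] by blast
  qed auto
  finally show ?thesis
    by simp
qed

lemma tokens_state_Suc: "tokens (state (Suc t)) v = (\<Sum>e\<in>in_arcs G v. load G nxt S0 t e)"
  by (simp add: state_Suc rotor_step_def load_def)

lemma pointer_state:
  assumes "s \<le> t"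
  shows "pointer (state t) v = (nxt ^^ (\<Sum>u\<in>{s..<t}. tokens (state u) v)) (pointer (state s) v)"
  using assms
  by (induction t rule: dec_induct)
    (simp_all add: state_Suc rotor_step_def funpow_funpow)

text \<open>A rotor does not notice how its tokens are divided among steps: those sent from
  \<open>s\<close> on can be numbered consecutively, starting with the pointer at time
  \<open>s\<close>.\<close>

lemma cumulative_load_eq_card:
  assumes "s \<le> t"
  shows "cumulative_load G nxt S0 s t e = card {j. j < (\<Sum>u\<in>{s..<t}. tokens (state u) (tail G e)) \<and>
    (nxt ^^ j) (pointer (state s) (tail G e)) = e}"
  using assms
proof (induction t rule: dec_induct)
  case base
  then show ?case
    by (simp add: cumulative_load_def)
next
  case (step t)
  then show ?case
    by (simp add: cumulative_load_def load_def sent_def card_less_add pointer_state[OF step(1)]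
        funpow_funpow)
qed

text \<open>The numbers of the tokens sent along two arcs of \<open>v\<close> form two residue
  classes modulo the degree of \<open>v\<close>.\<close>

lemma cumulative_load_balanced:
  assumes "v \<in> verts G" "e \<in> out_arcs G v" "f \<in> out_arcs G v"
  shows "cumulative_load G nxt S0 s t e \<le> cumulative_load G nxt S0 s t f + 1"
proof (cases "s \<le> t")
  case True
  have orb: "e \<in> orbit nxt (pointer (state s) v)" "f \<in> orbit nxt (pointer (state s) v)"
    using assms(2,3) unfolding out_arcs_state(1)[of v s, OF assms(1)] .
  note idx = funpow_cycle_length(3)[OF out_arcs_state(2)[of v s, OF assms(1)]]
  obtain r r' where "\<And>j. (nxt ^^ j) (pointer (state s) v) = e
        \<longleftrightarrow> j mod card (orbit nxt (pointer (state s) v)) = r"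
    and "\<And>j. (nxt ^^ j) (pointer (state s) v) = f
        \<longleftrightarrow> j mod card (orbit nxt (pointer (state s) v)) = r'"
    and "r' < card (orbit nxt (pointer (state s) v))"
    using idx[OF orb(1)] idx[OF orb(2)] by blast
  then show ?thesis
    using assms(2,3) cumulative_load_eq_card[OF True]
    by (simp add: card_arith_progression_le[simplified])
qed (simp add: cumulative_load_def)

lemma cumulative_load_shift:
  "cumulative_load G nxt S0 (T + s) (T + t) e = (\<Sum>u\<in>{s..<t}. load G nxt S0 (T + u) e)"
  using sum.shift_bounds_nat_ivl[of "\<lambda>u. load G nxt S0 u e" s T t]
  by (simp add: cumulative_load_def add.commute)

lemma balanced_flow_load: "balanced_flow G (\<lambda>t. load G nxt S0 (T + t))"
proof unfold_locales
  fix v t assume v: "v \<in> verts G"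
  show "in_degree G v = out_degree G v"
    using v by (rule eulerian)
  show "(\<Sum>e\<in>out_arcs G v. load G nxt S0 (T + Suc t) e)
      = (\<Sum>e\<in>in_arcs G v. load G nxt S0 (T + t) e)"
    using sum_load_out_arcs[OF v] tokens_state_Suc by simp
  show "(\<Sum>u\<in>{s..<t}. load G nxt S0 (T + u) e) \<le> (\<Sum>u\<in>{s..<t}. load G nxt S0 (T + u) f) + 1"
    if "e \<in> out_arcs G v" "f \<in> out_arcs G v" for e f s
    using cumulative_load_balanced[OF v that] unfolding cumulative_load_shift[symmetric] .
qed

text \<open>Periodic loads make the token counts periodic, but the pointers may have moved after one
  period. After \<open>K\<close> periods each vertex has sent a multiple of \<open>K\<close> tokens,
  and its out-degree divides \<open>K\<close>, so every rotor has made a whole number of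
  turns.\<close>

lemma stable_if_load_periodic:
  assumes "0 < P" and periodic: "\<And>e t. e \<in> arcs G \<Longrightarrow> load G nxt S0 (T + (t + P)) e = load G nxt S0 (T + t) e"
  shows "stable_at G nxt S0 T"
proof -
  define K :: nat where "K = fact (card (arcs G))"
  have tokens: "tokens (state (T + (t + k * P))) v = tokens (state (T + t)) v" for t k v
  proof (cases "v \<in> verts G")
    case True
    have "load G nxt S0 (T + (t + k * P)) e = load G nxt S0 (T + t) e" if "e \<in> arcs G" for e
      using periodic_mult[where a = "\<lambda>t. load G nxt S0 (T + t) e" and p = P and W = "t + k * P",
          OF periodic[OF that]] by simp
    then show ?thesis
      unfolding sum_load_out_arcs[OF True, symmetric] by (intro sum.cong) auto
  next
    case False
    then show ?thesis
      using rotor_state_on_state unfolding rotor_state_on_def by simp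
  qed
  have "pointer (state (T + K * P)) v = pointer (state T) v" for v
  proof -
    define X where "X = (\<Sum>u\<in>{0..<P}. tokens (state (T + u)) v)"
    have sum_tokens: "(\<Sum>u\<in>{0..<k * P}. tokens (state (T + u)) v) = k * X" for k
    proof (induction k)
      case (Suc k)
      have "(\<Sum>u\<in>{0..<Suc k * P}. tokens (state (T + u)) v)
          = k * X + (\<Sum>u\<in>{k * P..<k * P + P}. tokens (state (T + u)) v)"
        using Suc sum.atLeastLessThan_concat[of 0 "k * P" "k * P + P" "\<lambda>u. tokens (state (T + u)) v"]
        by (simp add: add.commute)
      also have "(\<Sum>u\<in>{k * P..<k * P + P}. tokens (state (T + u)) v) = X"
        using sum.shift_bounds_nat_ivl[of "\<lambda>u. tokens (state (T + u)) v" 0 "k * P" P] tokens[of _ k v]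
        by (simp add: X_def add.commute)
      finally show ?case
        by simp
    qed simp
    have "(\<Sum>u\<in>{T..<T + K * P}. tokens (state u) v) = K * X"
      using sum.shift_bounds_nat_ivl[of "\<lambda>u. tokens (state u) v" 0 T "K * P"] sum_tokens[of K]
      by (simp add: add.commute)
    then have pointer: "pointer (state (T + K * P)) v = (nxt ^^ (K * X)) (pointer (state T) v)"
      using pointer_state[of T "T + K * P" v] by simp
    show ?thesis
    proof (cases "v \<in> verts G")
      case True
      define n where "n = card (out_arcs G v)"
      have n: "0 < n" "(nxt ^^ n) (pointer (state T) v) = pointer (state T) v"
        using funpow_cycle_length[OF out_arcs_state(2)[of v T, OF True]]
        unfolding n_def out_arcs_state(1)[of v T, OF True] by simp_all
      have "n \<le> card (arcs G)"
        unfolding n_def by (intro card_mono) auto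
      then have "n dvd K"
        using n(1) by (simp add: K_def dvd_fact)
      then have "K * X mod n = 0"
        by simp
      then show ?thesis
        using pointer funpow_mod_eq[OF n(2), of "K * X"] by simp
    next
      case False
      then have "X = 0"
        using rotor_state_on_state unfolding X_def rotor_state_on_def by simp
      then show ?thesis
        using pointer by simp
    qed
  qed
  then have "state (T + K * P) = state T"
    using tokens[of 0 K] by (intro rotor_state.equality) auto
  moreover have "T + K * P > T"
    using \<open>0 < P\<close> by (simp add: K_def)
  ultimately show ?thesis
    unfolding stable_at_def by blast
qed


section \<open>Stability and equality of potentials\<close>

theorem stable_iff_potential_constant:
  assumes card: "card (arcs G) = 2 * m"
    and multi: "\<And>e f. e \<in> arcs G \<Longrightarrow> f \<in> arcs G \<Longrightarrow> e \<noteq> f \<Longrightarrow> head G e = head G f \<Longrightarrow> 2 \<le> m"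
  shows "stable_at G nxt S0 T \<longleftrightarrow>
    (\<Sum>i = 1..3 * m. potential G nxt S0 i T) = (\<Sum>i = 1..3 * m. potential G nxt S0 i (T + 2 * m\<^sup>2))"
proof -
  interpret balanced_flow G "\<lambda>t. load G nxt S0 (T + t)"
    by (rule balanced_flow_load)
  have potential: "potential G nxt S0 i (T + t) = energy i t" for i t
    unfolding potential_def energy_def flow_def cumulative_load_shift[symmetric]
    by (simp add: add.assoc)
  have potential_T: "potential G nxt S0 i T = energy i 0" for i
    using potential[of i 0] by simp
  show ?thesis
  proof
    assume "stable_at G nxt S0 T"
    then obtain T' where "T' > T" "state T' = state T"
      unfolding stable_at_def by blast
    then obtain P where P: "0 < P" "state (T + P) = state T"
      by (metis less_imp_add_positive)
    have "state (T + k * P) = state T" for k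
    proof (induction k)
      case (Suc k)
      then show ?case
        using P(2) state_add[of "T + k * P" P] state_add[of T P] by (simp add: add_ac)
    qed simp
    then have state: "state (T + (u + k * P)) = state (T + u)" for u k
      using state_add[of "T + k * P" u] state_add[of T u] by (simp add: add_ac)
    have "energy i (k * P) = energy i 0" for i k
      unfolding energy_def flow_def
      using sum.shift_bounds_nat_ivl[of "\<lambda>u. load G nxt S0 (T + u) _" 0 "k * P" i] state[of _ k]
      by (simp add: load_def add.commute)
    \<comment> \<open>The potentials never increase, yet have their initial value again at time
      \<open>2 * m\<^sup>2 * P\<close>, which is not before \<open>2 * m\<^sup>2\<close>.\<close>
    then have "energy i 0 \<le> energy i (2 * m\<^sup>2)" for i
      using energy_antimono[of "2 * m\<^sup>2" "2 * m\<^sup>2 * P" i] P(1) by simp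
    then have "energy i (2 * m\<^sup>2) = energy i 0" for i
      using energy_antimono[of 0 "2 * m\<^sup>2" i] by (simp add: antisym)
    then show "(\<Sum>i = 1..3 * m. potential G nxt S0 i T)
        = (\<Sum>i = 1..3 * m. potential G nxt S0 i (T + 2 * m\<^sup>2))"
      unfolding potential potential_T by simp
  next
    assume "(\<Sum>i = 1..3 * m. potential G nxt S0 i T)
        = (\<Sum>i = 1..3 * m. potential G nxt S0 i (T + 2 * m\<^sup>2))"
    then have eq: "(\<Sum>i = 1..3 * m. energy i (2 * m\<^sup>2)) = (\<Sum>i = 1..3 * m. energy i 0)"
      unfolding potential potential_T by simp
    \<comment> \<open>As no potential increases, equal sums force each one to keep its value over
      the whole span, and hence in each single step.\<close>
    have const: "energy i (2 * m\<^sup>2) = energy i 0" if "i \<in> {1..3 * m}" for i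
      using eq by (rule sum_mono_inv) (use that energy_antimono in auto)
    have short: "flow t (t + i) e \<le> flow t (t + i) f + 1"
      if "i \<le> 3 * m" "t < 2 * m\<^sup>2" and ef: "e \<in> arcs G" "f \<in> arcs G" "head G e = head G f"
      for i t e f
    proof (cases "i = 0")
      case True
      then show ?thesis
        by (simp add: flow_def)
    next
      case False
      then have "energy i (Suc t) = energy i t"
        using const[of i] that energy_antimono[of 0 t i] energy_antimono[of t "Suc t" i]
          energy_antimono[of "Suc t" "2 * m\<^sup>2" i] by simp
      then show ?thesis
        using ef by (rule in_balanced_if_energy_eq)
    qed
    have "in_balanced_upto W" for W
    proof (induction W)
      case 0
      then show ?case
        by (simp add: in_balanced_upto_def flow_def)
    next
      case (Suc W)
      show ?case
        by (rule in_balanced_upto_Suc[OF card multi short Suc])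
    qed
    then show "stable_at G nxt S0 T"
      using load_periodic by (intro stable_if_load_periodic[of "fact (card (arcs G))"]) auto
  qed
qed

end

section \<open>Undirected graphs as digraphs\<close>

theorem theorem3:
  fixes V :: "'v set" and E :: "'v set set" and G :: "('v, 'v \<times> 'v) pre_digraph"
    and nxt :: "'v \<times> 'v \<Rightarrow> 'v \<times> 'v" and S0 :: "('v, 'v \<times> 'v) rotor_state"
    and m T :: nat
  assumes "finite_simple_graph V E"
    and "G = bidirected V E"
    and "connected G"
    and "m = card E"
    and "rotor_order G nxt"
    and "rotor_state_on G S0"
  shows "stable_at G nxt S0 T \<longleftrightarrow>
    (\<Sum>i = 1..3 * m. potential G nxt S0 i T) = (\<Sum>i = 1..3 * m. potential G nxt S0 i (T + 2 * m\<^sup>2))"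
proof -
  have G: "verts G = V" "arcs G = {(u, v). {u, v} \<in> E}" "tail G = fst" "head G = snd"
    by (simp_all add: assms(2) bidirected_def)
  have V: "finite V" and E: "\<And>e. e \<in> E \<Longrightarrow> e \<subseteq> V \<and> card e = 2"
    using assms(1) by (auto simp: finite_simple_graph_def)
  have ends: "u \<in> V" "v \<in> V" "u \<noteq> v" if "{u, v} \<in> E" for u v
    using E[OF that] by (auto simp: card_2_iff doubleton_eq_iff)
  have fin: "finite E" "finite (arcs G)"
  proof -
    show "finite E"
      using V E by (intro finite_subset[of E "Pow V"]) auto
    show "finite (arcs G)"
      using V ends by (intro finite_subset[of "arcs G" "V \<times> V"]) (auto simp: G)
  qed
  have "(\<lambda>a. {fst a, snd a}) ` arcs G \<subseteq> E"
    by (auto simp: G)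
  from sum.group[OF fin(2,1) this, of "\<lambda>_. 1 :: nat"]
  have "card (arcs G) = (\<Sum>e\<in>E. card {a \<in> arcs G. {fst a, snd a} = e})"
    by simp
  also have "\<dots> = (\<Sum>e\<in>E. 2)"
  proof (rule sum.cong)
    fix e assume "e \<in> E"
    then obtain u v where e: "e = {u, v}" "u \<noteq> v"
      using E by (meson card_2_iff)
    have "{a \<in> arcs G. {fst a, snd a} = e} = {(u, v), (v, u)}"
      using \<open>e \<in> E\<close> e by (auto simp: G doubleton_eq_iff insert_commute)
    then show "card {a \<in> arcs G. {fst a, snd a} = e} = 2"
      using e by simp
  qed simp
  finally have card: "card (arcs G) = 2 * m"
    by (simp add: assms(4))
  interpret rotor_router G nxt S0
  proof
    fix v
    have "in_arcs G v = prod.swap ` out_arcs G v"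
      by (auto simp: G in_arcs_def out_arcs_def insert_commute image_iff)
    then show "in_degree G v = out_degree G v"
      by (simp add: in_degree_def out_degree_def card_image)
  qed (use assms(5,6) V fin ends in \<open>auto simp: G\<close>)
  show ?thesis
  proof (rule stable_iff_potential_constant[OF card])
    fix e f assume "e \<in> arcs G" "f \<in> arcs G" "e \<noteq> f" "head G e = head G f"
    \<comment> \<open>In a simple graph, two arcs with the same head and different tails come from
      different edges.\<close>
    then have ef: "{fst e, snd e} \<in> E" "{fst f, snd e} \<in> E" "fst e \<noteq> fst f"
      by (auto simp: G prod_eq_iff)
    then have "{fst e, snd e} \<noteq> {fst f, snd e}"
      by (auto simp: doubleton_eq_iff)
    with ef show "2 \<le> m"
      using card_mono[OF fin(1), of "{{fst e, snd e}, {fst f, snd e}}"] by (simp add: assms(4))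
  qed
qed

end
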